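(* For all $\xi\in\mathcal{L}_{NF}$: if $\mathsf{Clo}_G\vdash\xi$ then $\mathsf{G}\vdash\xi$.
   Context: Fix countable sets $\mathsf{P}_0$, $\mathsf{G}_0$. $\mathcal{L}_{NF}$/$\mathcal{G}_{NF}$: $\varphi ::= p \mid \neg p \mid \varphi\lor\varphi \mid \varphi\land\varphi \mid \langle\gamma\rangle\varphi$, $\gamma ::= g \mid g^d \mid \gamma;\gamma \mid \gamma\sqcup\gamma \mid \gamma\sqcap\gamma \mid \gamma^* \mid \gamma^\times \mid \varphi? \mid \varphi!$. Complement/dual: $\overline p=\neg p$, $\overline{\neg p}=p$, $\overline{\varphi\lor\psi}=\overline\varphi\land\overline\psi$, $\overline{\varphi\land\psi}=\overline\varphi\lor\overline\psi$, $\overline{\langle\gamma\rangle\varphi}=\langle\check\gamma\rangle\overline\varphi$; $\check g=g^d$, $\check{(g^d)}=g$, $\check{(\gamma;\delta)}=\check\gamma;\check\delta$, $\check{(\gamma\sqcup\delta)}=\check\gamma\sqcap\check\delta$, $\check{(\gamma\sqcap\delta)}=\check\gamma\sqcup\check\delta$, $\check{(\gamma^* )}=(\check\gamma)^\times$, $\check{(\gamma^\times)}=(\check\gamma)^*$, $\check{(\varphi?)}=\overline\varphi!$, $\check{(\varphi!)}=\overline\varphi?$; for finite $\Phi=\{\varphi_1,\dots,\varphi_n\}$, $\overline\Phi=\overline{\varphi_1}\land\dots\land\overline{\varphi_n}$. $\mathsf{G}$: sequent calculus on finite sets of $\mathcal{L}_{NF}$-formulas with rules: axiom $\Phi,\overline\Phi$;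 $\Phi/\Phi,\varphi$; $\varphi,\psi/\langle g\rangle\varphi,\langle g^d\rangle\psi$; $\Phi,\varphi,\psi/\Phi,\varphi\lor\psi$; $\Phi,\varphi$ and $\Phi,\psi/\Phi,\varphi\land\psi$; $\Phi,\varphi\lor\langle\gamma\rangle\langle\gamma^*\rangle\varphi/\Phi,\langle\gamma^*\rangle\varphi$; $\Phi,\varphi\land\langle\gamma\rangle\langle\gamma^\times\rangle\varphi/\Phi,\langle\gamma^\times\rangle\varphi$; $\Phi,\langle\gamma\rangle\varphi\lor\langle\delta\rangle\varphi/\Phi,\langle\gamma\sqcup\delta\rangle\varphi$; $\Phi,\langle\gamma\rangle\varphi\land\langle\delta\rangle\varphi/\Phi,\langle\gamma\sqcap\delta\rangle\varphi$; $\Phi,\psi\land\varphi/\Phi,\langle\psi?\rangle\varphi$; $\Phi,\psi\lor\varphi/\Phi,\langle\psi!\rangle\varphi$; deep rules ($\psi(\cdot)$ a formula with a unique placeholder occurrence of formula or game sort): $\Phi,\psi(\gamma)/\Phi,\psi(\chi!;\gamma)$; $\Phi,\psi(\varphi)/\Phi,\psi(\langle\chi!\rangle\varphi)$; $\Phi,\psi(\langle\gamma\rangle\langle\delta\rangle\varphi)/\Phi,\psi(\langle\gamma;\delta\rangle\varphi)$; $\Phi,\varphi\land\langle\gamma\rangle\langle(\overline\Phi!;\gamma)^\times\rangle\langle\overline\Phi!\rangle\varphi/\Phi,\langle\gamma^\times\rangle\varphi$. $\mathsf{G}\vdash\xi$: finite derivation of $\{\xi\}$ with axiom leaves. Fixpoint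 formulas $F^*=\{\langle\gamma^*\rangle\varphi\}$, $F^\times=\{\langle\gamma^\times\rangle\varphi\}$, $F=F^*\cup F^\times$; $\langle\gamma^\circ\rangle\varphi\le_{fp}\langle\delta^\dagger\rangle\psi$ iff $\delta^\dagger$ is a (not necessarily proper) subterm of $\gamma^\circ$. Each $\theta\in F^\times$ has a countable set $N_\theta$ of names (pairwise disjoint); for names $x\in N_\theta,y\in N_\eta$, $x\le_{fp}y$ iff $\theta\le_{fp}\eta$. An annotation is a non-repeating finite sequence of names, $\le_{fp}$-monotone; $\varepsilon$ empty; $a\le_{fp}\theta$ means every name in $a$ is $\le_{fp}\theta$. $\mathsf{Clo}_G$ works on finite sets of annotated formulas $\varphi^a$ with rules: axiom $p^\varepsilon,(\neg p)^\varepsilon$; $\Phi,\varphi^a,\psi^a/\Phi,(\varphi\lor\psi)^a$; $\Phi,\varphi^a$ and $\Phi,\psi^a/\Phi,(\varphi\land\psi)^a$; $\varphi^a,\psi^b/(\langle g\rangle\varphi)^a,(\langle g^d\rangle\psi)^b$; $\Phi,(\langle\gamma\rangle\varphi\lor\langle\delta\rangle\varphi)^a/\Phi,(\langle\gamma\sqcup\delta\rangle\varphi)^a$; $\Phi,(\langle\gamma\rangle\varphi\land\langle\delta\rangle\varphi)^a/\Phi,(\langle\gamma\sqcap\delta\rangle\varphi)^a$; $\Phi/\Phi,\varphi^a$; $\Phi,\varphi^{ab}/\Phi,\varphi^{axb}$; $\Phi,(\langle\gamma\rangle\langle\delta\rangle\varphi)^a/\Phi,(\langle\gamma;\delta\rangle\varphi)^a$;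 $\Phi,(\varphi\lor\langle\gamma\rangle\langle\gamma^*\rangle\varphi)^a/\Phi,(\langle\gamma^*\rangle\varphi)^a$ if $a\le_{fp}\langle\gamma^*\rangle\varphi$; $\Phi,(\varphi\land\langle\gamma\rangle\langle\gamma^\times\rangle\varphi)^a/\Phi,(\langle\gamma^\times\rangle\varphi)^a$ if $a\le_{fp}\langle\gamma^\times\rangle\varphi$; $\Phi,(\psi\land\varphi)^a/\Phi,(\langle\psi?\rangle\varphi)^a$; $\Phi,(\psi\lor\varphi)^a/\Phi,(\langle\psi!\rangle\varphi)^a$; closure $\mathsf{clo}_x$: from a derivation of $\Phi,(\varphi\land\langle\gamma\rangle\langle\gamma^\times\rangle\varphi)^{ax}$ infer $\Phi,(\langle\gamma^\times\rangle\varphi)^a$, discharging assumptions $\Phi,(\langle\gamma^\times\rangle\varphi)^{ax}$, provided $x\in N_{\langle\gamma^\times\rangle\varphi}$, $a\le_{fp}x$, $x$ not occurring in $\Phi$ or $a$. A proof is a finite tree whose leaves are axioms or discharged assumptions; $\mathsf{Clo}_G\vdash\xi$ means there is a proof of $\{\xi^\varepsilon\}$.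
   Formalization: Proofs in Clo_G are required to use different names x for closure rules nested on one branch; with only the listed side conditions, an inner clo_x may reuse x and the outer one be discharged wrongly, making Clo_G unsound and the claim false. The empty conjunction is read as p ∨ ¬p. *)

theory Defs
  imports "HOL-Library.FSet" "HOL-Library.Countable"
begin

section \<open>Syntax\<close>

datatype ('p, 'g) fml =
    Pos 'p
  | Neg 'p
  | Or "('p, 'g) fml" "('p, 'g) fml"
  | And "('p, 'g) fml" "('p, 'g) fml"
  | Dia "('p, 'g) game" "('p, 'g) fml"
and ('p, 'g) game =
    Atm 'g
  | DAtm 'g
  | Seq "('p, 'g) game" "('p, 'g) game"
  | Cup "('p, 'g) game" "('p, 'g) game"
  | Cap "('p, 'g) game" "('p, 'g) game"
  | Star "('p, 'g) game"
  | Cross "('p, 'g) game"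
  | Test "('p, 'g) fml"    \<comment> \<open>the game \<open>\<phi>?\<close>\<close>
  | DTest "('p, 'g) fml"   \<comment> \<open>the game \<open>\<phi>!\<close>\<close>

primrec compl :: "('p, 'g) fml \<Rightarrow> ('p, 'g) fml"
  and dual :: "('p, 'g) game \<Rightarrow> ('p, 'g) game"
where
  "compl (Pos p) = Neg p"
| "compl (Neg p) = Pos p"
| "compl (Or \<phi> \<psi>) = And (compl \<phi>) (compl \<psi>)"
| "compl (And \<phi> \<psi>) = Or (compl \<phi>) (compl \<psi>)"
| "compl (Dia \<gamma> \<phi>) = Dia (dual \<gamma>) (compl \<phi>)"
| "dual (Atm g) = DAtm g"
| "dual (DAtm g) = Atm g"
| "dual (Seq \<gamma> \<delta>) = Seq (dual \<gamma>) (dual \<delta>)"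
| "dual (Cup \<gamma> \<delta>) = Cap (dual \<gamma>) (dual \<delta>)"
| "dual (Cap \<gamma> \<delta>) = Cup (dual \<gamma>) (dual \<delta>)"
| "dual (Star \<gamma>) = Cross (dual \<gamma>)"
| "dual (Cross \<gamma>) = Star (dual \<gamma>)"
| "dual (Test \<phi>) = DTest (compl \<phi>)"
| "dual (DTest \<phi>) = Test (compl \<phi>)"

text \<open>The language has no primitive truth constant; the empty conjunction is
  read as \<open>p \<or> \<not>p\<close> for an arbitrary but fixed \<open>p\<close>.\<close>

definition Top :: "('p, 'g) fml" where
  "Top = Or (Pos (SOME p. True)) (Neg (SOME p. True))"

fun conj_list :: "('p, 'g) fml list \<Rightarrow> ('p, 'g) fml" where
  "conj_list [] = Top"
| "conj_list [\<phi>] = \<phi>"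
| "conj_list (\<phi> # \<psi> # \<phi>s) = And \<phi> (conj_list (\<psi> # \<phi>s))"

text \<open>The conjunction of the complements, taken along an arbitrary but fixed
  enumeration of the sequent without repetitions.\<close>

definition seq_compl :: "('p, 'g) fml fset \<Rightarrow> ('p, 'g) fml" where
  "seq_compl \<Phi> = conj_list (map compl (SOME \<phi>s. distinct \<phi>s \<and> fset_of_list \<phi>s = \<Phi>))"


section \<open>Contexts\<close>

text \<open>Terms with exactly one placeholder, of formula sort (\<open>FHole\<close>) or of game
  sort (\<open>GHole\<close>).\<close>

datatype ('p, 'g) fctx =
    FHole
  | OrL "('p, 'g) fctx" "('p, 'g) fml"
  | OrR "('p, 'g) fml" "('p, 'g) fctx"
  | AndL "('p, 'g) fctx" "('p, 'g) fml"
  | AndR "('p, 'g) fml" "('p, 'g) fctx"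
  | DiaL "('p, 'g) gctx" "('p, 'g) fml"
  | DiaR "('p, 'g) game" "('p, 'g) fctx"
and ('p, 'g) gctx =
    GHole
  | SeqL "('p, 'g) gctx" "('p, 'g) game"
  | SeqR "('p, 'g) game" "('p, 'g) gctx"
  | CupL "('p, 'g) gctx" "('p, 'g) game"
  | CupR "('p, 'g) game" "('p, 'g) gctx"
  | CapL "('p, 'g) gctx" "('p, 'g) game"
  | CapR "('p, 'g) game" "('p, 'g) gctx"
  | StarC "('p, 'g) gctx"
  | CrossC "('p, 'g) gctx"
  | TestC "('p, 'g) fctx"
  | DTestC "('p, 'g) fctx"

text \<open>\<open>fill C \<phi> \<gamma>\<close> puts \<open>\<phi>\<close> into the placeholder if it is of formula sort, and
  \<open>\<gamma>\<close> if it is of game sort; the other argument is ignored.\<close>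

primrec fill :: "('p, 'g) fctx \<Rightarrow> ('p, 'g) fml \<Rightarrow> ('p, 'g) game \<Rightarrow> ('p, 'g) fml"
  and gfill :: "('p, 'g) gctx \<Rightarrow> ('p, 'g) fml \<Rightarrow> ('p, 'g) game \<Rightarrow> ('p, 'g) game"
where
  "fill FHole \<phi> \<gamma> = \<phi>"
| "fill (OrL C \<psi>) \<phi> \<gamma> = Or (fill C \<phi> \<gamma>) \<psi>"
| "fill (OrR \<psi> C) \<phi> \<gamma> = Or \<psi> (fill C \<phi> \<gamma>)"
| "fill (AndL C \<psi>) \<phi> \<gamma> = And (fill C \<phi> \<gamma>) \<psi>"
| "fill (AndR \<psi> C) \<phi> \<gamma> = And \<psi> (fill C \<phi> \<gamma>)"
| "fill (DiaL D \<psi>) \<phi> \<gamma> = Dia (gfill D \<phi> \<gamma>) \<psi>"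
| "fill (DiaR \<delta> C) \<phi> \<gamma> = Dia \<delta> (fill C \<phi> \<gamma>)"
| "gfill GHole \<phi> \<gamma> = \<gamma>"
| "gfill (SeqL D \<delta>) \<phi> \<gamma> = Seq (gfill D \<phi> \<gamma>) \<delta>"
| "gfill (SeqR \<delta> D) \<phi> \<gamma> = Seq \<delta> (gfill D \<phi> \<gamma>)"
| "gfill (CupL D \<delta>) \<phi> \<gamma> = Cup (gfill D \<phi> \<gamma>) \<delta>"
| "gfill (CupR \<delta> D) \<phi> \<gamma> = Cup \<delta> (gfill D \<phi> \<gamma>)"
| "gfill (CapL D \<delta>) \<phi> \<gamma> = Cap (gfill D \<phi> \<gamma>) \<delta>"
| "gfill (CapR \<delta> D) \<phi> \<gamma> = Cap \<delta> (gfill D \<phi> \<gamma>)"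
| "gfill (StarC D) \<phi> \<gamma> = Star (gfill D \<phi> \<gamma>)"
| "gfill (CrossC D) \<phi> \<gamma> = Cross (gfill D \<phi> \<gamma>)"
| "gfill (TestC C) \<phi> \<gamma> = Test (fill C \<phi> \<gamma>)"
| "gfill (DTestC C) \<phi> \<gamma> = DTest (fill C \<phi> \<gamma>)"


section \<open>The calculus G\<close>

text \<open>In the first two deep rules the ignored argument of \<open>fill\<close> is an arbitrary
  term that is the same in premise and conclusion. If the placeholder is of the
  other sort, premise and conclusion coincide, so such instances are void.\<close>

inductive G :: "('p, 'g) fml fset \<Rightarrow> bool" where
  G_ax: "G (finsert (seq_compl \<Phi>) \<Phi>)"
| G_weak: "G \<Phi> \<Longrightarrow> G (finsert \<phi> \<Phi>)"
| G_mod: "G {|\<phi>, \<psi>|} \<Longrightarrow> G {|Dia (Atm g) \<phi>, Dia (DAtm g) \<psi>|}"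
| G_or: "G (finsert \<phi> (finsert \<psi> \<Phi>)) \<Longrightarrow> G (finsert (Or \<phi> \<psi>) \<Phi>)"
| G_and: "G (finsert \<phi> \<Phi>) \<Longrightarrow> G (finsert \<psi> \<Phi>) \<Longrightarrow> G (finsert (And \<phi> \<psi>) \<Phi>)"
| G_star: "G (finsert (Or \<phi> (Dia \<gamma> (Dia (Star \<gamma>) \<phi>))) \<Phi>)
    \<Longrightarrow> G (finsert (Dia (Star \<gamma>) \<phi>) \<Phi>)"
| G_cross: "G (finsert (And \<phi> (Dia \<gamma> (Dia (Cross \<gamma>) \<phi>))) \<Phi>)
    \<Longrightarrow> G (finsert (Dia (Cross \<gamma>) \<phi>) \<Phi>)"
| G_cup: "G (finsert (Or (Dia \<gamma> \<phi>) (Dia \<delta> \<phi>)) \<Phi>) \<Longrightarrow> G (finsert (Dia (Cup \<gamma> \<delta>) \<phi>) \<Phi>)"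
| G_cap: "G (finsert (And (Dia \<gamma> \<phi>) (Dia \<delta> \<phi>)) \<Phi>) \<Longrightarrow> G (finsert (Dia (Cap \<gamma> \<delta>) \<phi>) \<Phi>)"
| G_test: "G (finsert (And \<psi> \<phi>) \<Phi>) \<Longrightarrow> G (finsert (Dia (Test \<psi>) \<phi>) \<Phi>)"
| G_dtest: "G (finsert (Or \<psi> \<phi>) \<Phi>) \<Longrightarrow> G (finsert (Dia (DTest \<psi>) \<phi>) \<Phi>)"
| G_deep_game: "G (finsert (fill C \<phi> \<gamma>) \<Phi>)
    \<Longrightarrow> G (finsert (fill C \<phi> (Seq (DTest \<chi>) \<gamma>)) \<Phi>)"
| G_deep_fml: "G (finsert (fill C \<phi> \<gamma>) \<Phi>)
    \<Longrightarrow> G (finsert (fill C (Dia (DTest \<chi>) \<phi>) \<gamma>) \<Phi>)"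
| G_deep_seq: "G (finsert (fill C (Dia \<gamma> (Dia \<delta> \<phi>)) \<epsilon>) \<Phi>)
    \<Longrightarrow> G (finsert (fill C (Dia (Seq \<gamma> \<delta>) \<phi>) \<epsilon>) \<Phi>)"
| G_ind: "G (finsert (And \<phi> (Dia \<gamma> (Dia (Cross (Seq (DTest (seq_compl \<Phi>)) \<gamma>))
      (Dia (DTest (seq_compl \<Phi>)) \<phi>)))) \<Phi>)
    \<Longrightarrow> G (finsert (Dia (Cross \<gamma>) \<phi>) \<Phi>)"

definition G_provable :: "('p, 'g) fml \<Rightarrow> bool" where
  "G_provable \<xi> \<longleftrightarrow> G {|\<xi>|}"


section \<open>Fixpoint order, names and annotations\<close>

definition fp_star :: "('p, 'g) fml set" where
  "fp_star = {Dia (Star \<gamma>) \<phi> | \<gamma> \<phi>. True}"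

definition fp_cross :: "('p, 'g) fml set" where
  "fp_cross = {Dia (Cross \<gamma>) \<phi> | \<gamma> \<phi>. True}"

text \<open>The subterms of game sort, including those inside the formulas of tests.\<close>

primrec fsubgames :: "('p, 'g) fml \<Rightarrow> ('p, 'g) game set"
  and subgames :: "('p, 'g) game \<Rightarrow> ('p, 'g) game set"
where
  "fsubgames (Pos p) = {}"
| "fsubgames (Neg p) = {}"
| "fsubgames (Or \<phi> \<psi>) = fsubgames \<phi> \<union> fsubgames \<psi>"
| "fsubgames (And \<phi> \<psi>) = fsubgames \<phi> \<union> fsubgames \<psi>"
| "fsubgames (Dia \<gamma> \<phi>) = subgames \<gamma> \<union> fsubgames \<phi>"
| "subgames (Atm g) = {Atm g}"
| "subgames (DAtm g) = {DAtm g}"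
| "subgames (Seq \<gamma> \<delta>) = {Seq \<gamma> \<delta>} \<union> subgames \<gamma> \<union> subgames \<delta>"
| "subgames (Cup \<gamma> \<delta>) = {Cup \<gamma> \<delta>} \<union> subgames \<gamma> \<union> subgames \<delta>"
| "subgames (Cap \<gamma> \<delta>) = {Cap \<gamma> \<delta>} \<union> subgames \<gamma> \<union> subgames \<delta>"
| "subgames (Star \<gamma>) = {Star \<gamma>} \<union> subgames \<gamma>"
| "subgames (Cross \<gamma>) = {Cross \<gamma>} \<union> subgames \<gamma>"
| "subgames (Test \<phi>) = {Test \<phi>} \<union> fsubgames \<phi>"
| "subgames (DTest \<phi>) = {DTest \<phi>} \<union> fsubgames \<phi>"

definition le_fp :: "('p, 'g) fml \<Rightarrow> ('p, 'g) fml \<Rightarrow> bool" where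
  "le_fp \<theta> \<eta> \<longleftrightarrow> \<theta> \<in> fp_star \<union> fp_cross \<and> \<eta> \<in> fp_star \<union> fp_cross \<and>
     (\<exists>\<alpha> \<phi> \<beta> \<psi>. \<theta> = Dia \<alpha> \<phi> \<and> \<eta> = Dia \<beta> \<psi> \<and> \<beta> \<in> subgames \<alpha>)"

text \<open>\<open>Name \<gamma> \<phi> n\<close> is the \<open>n\<close>-th name of the formula \<open>\<langle>\<gamma>\<^sup>\<times>\<rangle>\<phi>\<close>, so that the sets
  of names are countably infinite and pairwise disjoint.\<close>

datatype ('p, 'g) name = Name "('p, 'g) game" "('p, 'g) fml" nat

primrec owner :: "('p, 'g) name \<Rightarrow> ('p, 'g) fml" where
  "owner (Name \<gamma> \<phi> n) = Dia (Cross \<gamma>) \<phi>"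

definition names :: "('p, 'g) fml \<Rightarrow> ('p, 'g) name set" where
  "names \<theta> = {x. owner x = \<theta>}"

definition name_le :: "('p, 'g) name \<Rightarrow> ('p, 'g) name \<Rightarrow> bool" where
  "name_le x y \<longleftrightarrow> le_fp (owner x) (owner y)"

definition annotation :: "('p, 'g) name list \<Rightarrow> bool" where
  "annotation a \<longleftrightarrow> distinct a \<and> sorted_wrt name_le a"

definition ann_le :: "('p, 'g) name list \<Rightarrow> ('p, 'g) fml \<Rightarrow> bool" where
  "ann_le a \<theta> \<longleftrightarrow> (\<forall>x\<in>set a. le_fp (owner x) \<theta>)"


section \<open>The calculus Clo\<close>

type_synonym ('p, 'g) afml = "('p, 'g) fml \<times> ('p, 'g) name list"

text \<open>\<open>Clo H \<Gamma>\<close>: there is a derivation of \<open>\<Gamma>\<close> whose undischarged leaves are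
  assumptions \<open>H x\<close>, where \<open>x\<close> labels the application of the closure rule that is
  to discharge them. Labels are unique along
  each branch: a name still in use (\<open>x \<in> dom H\<close>) is not bound again further up.
  Without this usual discharge convention a leaf could be discharged by a closure
  whose name has been dropped and rebound in between, which is unsound. In a
  derivation of \<open>\<xi>\<^sup>\<epsilon>\<close> without undischarged assumptions, all annotations that occur
  satisfy \<open>annotation\<close>: rules other than \<open>Clo_clo\<close> introduce no new name upwards, and
  \<open>Clo_clo\<close> preserves the property.\<close>

inductive Clo ::
  "(('p, 'g) name \<rightharpoonup> ('p, 'g) afml fset) \<Rightarrow> ('p, 'g) afml fset \<Rightarrow> bool"
where
  Clo_hyp: "H x = Some \<Gamma> \<Longrightarrow> Clo H \<Gamma>"
| Clo_ax: "Clo H {|(Pos p, []), (Neg p, [])|}"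
| Clo_or: "Clo H (finsert (\<phi>, a) (finsert (\<psi>, a) \<Phi>)) \<Longrightarrow> Clo H (finsert (Or \<phi> \<psi>, a) \<Phi>)"
| Clo_and: "Clo H (finsert (\<phi>, a) \<Phi>) \<Longrightarrow> Clo H (finsert (\<psi>, a) \<Phi>)
    \<Longrightarrow> Clo H (finsert (And \<phi> \<psi>, a) \<Phi>)"
| Clo_mod: "Clo H {|(\<phi>, a), (\<psi>, b)|}
    \<Longrightarrow> Clo H {|(Dia (Atm g) \<phi>, a), (Dia (DAtm g) \<psi>, b)|}"
| Clo_cup: "Clo H (finsert (Or (Dia \<gamma> \<phi>) (Dia \<delta> \<phi>), a) \<Phi>)
    \<Longrightarrow> Clo H (finsert (Dia (Cup \<gamma> \<delta>) \<phi>, a) \<Phi>)"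
| Clo_cap: "Clo H (finsert (And (Dia \<gamma> \<phi>) (Dia \<delta> \<phi>), a) \<Phi>)
    \<Longrightarrow> Clo H (finsert (Dia (Cap \<gamma> \<delta>) \<phi>, a) \<Phi>)"
| Clo_weak: "Clo H \<Phi> \<Longrightarrow> annotation a \<Longrightarrow> Clo H (finsert (\<phi>, a) \<Phi>)"
| Clo_exp: "Clo H (finsert (\<phi>, a @ b) \<Phi>) \<Longrightarrow> annotation (a @ x # b)
    \<Longrightarrow> Clo H (finsert (\<phi>, a @ x # b) \<Phi>)"
| Clo_seq: "Clo H (finsert (Dia \<gamma> (Dia \<delta> \<phi>), a) \<Phi>)
    \<Longrightarrow> Clo H (finsert (Dia (Seq \<gamma> \<delta>) \<phi>, a) \<Phi>)"
| Clo_star: "Clo H (finsert (Or \<phi> (Dia \<gamma> (Dia (Star \<gamma>) \<phi>)), a) \<Phi>)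
    \<Longrightarrow> ann_le a (Dia (Star \<gamma>) \<phi>)
    \<Longrightarrow> Clo H (finsert (Dia (Star \<gamma>) \<phi>, a) \<Phi>)"
| Clo_cross: "Clo H (finsert (And \<phi> (Dia \<gamma> (Dia (Cross \<gamma>) \<phi>)), a) \<Phi>)
    \<Longrightarrow> ann_le a (Dia (Cross \<gamma>) \<phi>)
    \<Longrightarrow> Clo H (finsert (Dia (Cross \<gamma>) \<phi>, a) \<Phi>)"
| Clo_test: "Clo H (finsert (And \<psi> \<phi>, a) \<Phi>) \<Longrightarrow> Clo H (finsert (Dia (Test \<psi>) \<phi>, a) \<Phi>)"
| Clo_dtest: "Clo H (finsert (Or \<psi> \<phi>, a) \<Phi>) \<Longrightarrow> Clo H (finsert (Dia (DTest \<psi>) \<phi>, a) \<Phi>)"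
| Clo_clo: "Clo (H(x \<mapsto> finsert (Dia (Cross \<gamma>) \<phi>, a @ [x]) \<Phi>))
      (finsert (And \<phi> (Dia \<gamma> (Dia (Cross \<gamma>) \<phi>)), a @ [x]) \<Phi>)
    \<Longrightarrow> x \<in> names (Dia (Cross \<gamma>) \<phi>)
    \<Longrightarrow> \<forall>y\<in>set a. name_le y x
    \<Longrightarrow> x \<notin> set a
    \<Longrightarrow> \<forall>(\<psi>, b)\<in>fset \<Phi>. x \<notin> set b
    \<Longrightarrow> x \<notin> dom H
    \<Longrightarrow> Clo H (finsert (Dia (Cross \<gamma>) \<phi>, a) \<Phi>)"

definition Clo_provable :: "('p, 'g) fml \<Rightarrow> bool" where
  "Clo_provable \<xi> \<longleftrightarrow> Clo Map.empty {|(\<xi>, [])|}"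

end

theory Submission
  imports Defs
begin

text \<open>A name \<open>x\<close> of \<open>\<langle>\<gamma>\<^sup>\<times>\<rangle>\<phi>\<close>, introduced by a closure with side sequent \<open>\<Phi>\<close>, is
  read as the formula \<open>\<chi>\<^sub>x\<close>, the complement of the translation of \<open>\<Phi>\<close>. An
  annotated formula is translated by replacing \<open>\<langle>\<gamma>\<^sup>\<times>\<rangle>\<phi>\<close> by
  \<open>\<langle>(\<chi>\<^sub>n!;\<dots>;\<chi>\<^sub>1!;\<gamma>)\<^sup>\<times>\<rangle>\<langle>\<chi>\<^sub>n!\<rangle>\<dots>\<langle>\<chi>\<^sub>1!\<rangle>\<phi>\<close>, where \<open>\<chi>\<^sub>1, \<dots>, \<chi>\<^sub>n\<close> belong to the names of this
  formula in the annotation. A discharged assumption then becomes derivable from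
  \<open>\<Phi>, \<chi>\<^sub>x\<close>, the closure rule becomes the strengthened induction rule, and
  dropping a name deletes a guard, which is what the deep rules allow.
  Names may only be kept while the fixpoints unfolded are subterms of their
  owner; comparing sizes, this keeps the translation in step with the rules that
  decompose games.\<close>

subsection \<open>Deep inference\<close>

text \<open>Composition of contexts. The hole of the outer one may be of either sort, so an inner
  context of each sort is supplied and the matching one is plugged in.\<close>

primrec fplug :: "('p, 'g) fctx \<Rightarrow> ('p, 'g) fctx \<Rightarrow> ('p, 'g) gctx \<Rightarrow> ('p, 'g) fctx"
  and gplug :: "('p, 'g) gctx \<Rightarrow> ('p, 'g) fctx \<Rightarrow> ('p, 'g) gctx \<Rightarrow> ('p, 'g) gctx"
where
  "fplug FHole F D = F"
| "fplug (OrL C \<psi>) F D = OrL (fplug C F D) \<psi>"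
| "fplug (OrR \<psi> C) F D = OrR \<psi> (fplug C F D)"
| "fplug (AndL C \<psi>) F D = AndL (fplug C F D) \<psi>"
| "fplug (AndR \<psi> C) F D = AndR \<psi> (fplug C F D)"
| "fplug (DiaL C \<psi>) F D = DiaL (gplug C F D) \<psi>"
| "fplug (DiaR \<delta> C) F D = DiaR \<delta> (fplug C F D)"
| "gplug GHole F D = D"
| "gplug (SeqL C \<delta>) F D = SeqL (gplug C F D) \<delta>"
| "gplug (SeqR \<delta> C) F D = SeqR \<delta> (gplug C F D)"
| "gplug (CupL C \<delta>) F D = CupL (gplug C F D) \<delta>"
| "gplug (CupR \<delta> C) F D = CupR \<delta> (gplug C F D)"
| "gplug (CapL C \<delta>) F D = CapL (gplug C F D) \<delta>"
| "gplug (CapR \<delta> C) F D = CapR \<delta> (gplug C F D)"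
| "gplug (StarC C) F D = StarC (gplug C F D)"
| "gplug (CrossC C) F D = CrossC (gplug C F D)"
| "gplug (TestC C) F D = TestC (fplug C F D)"
| "gplug (DTestC C) F D = DTestC (fplug C F D)"

lemma fill_fplug:
  "fill (fplug C F D) \<phi> \<gamma> = fill C (fill F \<phi> \<gamma>) (gfill D \<phi> \<gamma>)"
  "gfill (gplug C' F D) \<phi> \<gamma> = gfill C' (fill F \<phi> \<gamma>) (gfill D \<phi> \<gamma>)"
  by (induction C and C') simp_all

text \<open>A context has a single hole, so one argument of \<open>fill\<close> is ignored
  throughout. When contexts are composed, that argument can be exchanged freely.\<close>

lemma fill_one_sort:
  fixes C :: "('p, 'g) fctx" and C' :: "('p, 'g) gctx"
  shows "(\<forall>\<phi> \<phi>' \<gamma>. fill C \<phi> \<gamma> = fill C \<phi>' \<gamma>) \<or> (\<forall>\<phi> \<gamma> \<gamma>'. fill C \<phi> \<gamma> = fill C \<phi> \<gamma>')"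
  "(\<forall>\<phi> \<phi>' \<gamma>. gfill C' \<phi> \<gamma> = gfill C' \<phi>' \<gamma>) \<or> (\<forall>\<phi> \<gamma> \<gamma>'. gfill C' \<phi> \<gamma> = gfill C' \<phi> \<gamma>')"
  by (induction C and C') auto

text \<open>Quantifying over all contexts and side sequents builds congruence into the relation; the
  deep rules supply its basic instances.\<close>

definition deep_le :: "('p, 'g) fml \<Rightarrow> ('p, 'g) fml \<Rightarrow> bool" where
  "deep_le \<phi> \<psi> \<longleftrightarrow>
     (\<forall>C \<gamma> \<Phi>. G (finsert (fill C \<phi> \<gamma>) \<Phi>) \<longrightarrow> G (finsert (fill C \<psi> \<gamma>) \<Phi>))"

definition deep_gle :: "('p, 'g) game \<Rightarrow> ('p, 'g) game \<Rightarrow> bool" where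
  "deep_gle \<gamma> \<delta> \<longleftrightarrow>
     (\<forall>C \<phi> \<Phi>. G (finsert (fill C \<phi> \<gamma>) \<Phi>) \<longrightarrow> G (finsert (fill C \<phi> \<delta>) \<Phi>))"

lemma deep_leD: "deep_le \<phi> \<psi> \<Longrightarrow> G (finsert \<phi> \<Phi>) \<Longrightarrow> G (finsert \<psi> \<Phi>)"
  unfolding deep_le_def by (drule spec[of _ FHole]) simp

lemma deep_le_refl [simp]: "deep_le \<phi> \<phi>" and deep_gle_refl [simp]: "deep_gle \<gamma> \<gamma>"
  by (simp_all add: deep_le_def deep_gle_def)

lemma deep_le_trans: "deep_le \<phi> \<psi> \<Longrightarrow> deep_le \<psi> \<chi> \<Longrightarrow> deep_le \<phi> \<chi>"
  and deep_gle_trans: "deep_gle \<gamma> \<delta> \<Longrightarrow> deep_gle \<delta> \<epsilon> \<Longrightarrow> deep_gle \<gamma> \<epsilon>"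
  by (simp_all add: deep_le_def deep_gle_def)

lemma deep_le_fill:
  assumes "deep_le \<phi> \<psi>"
  shows "deep_le (fill F \<phi> \<gamma>) (fill F \<psi> \<gamma>)"
  unfolding deep_le_def
proof (intro allI)
  fix C \<delta> \<Phi>
  have step: "G (finsert (fill (fplug C F GHole) \<phi> \<gamma>) \<Phi>) \<longrightarrow> G (finsert (fill (fplug C F GHole) \<psi> \<gamma>) \<Phi>)"
    using assms unfolding deep_le_def by blast
  show "G (finsert (fill C (fill F \<phi> \<gamma>) \<delta>) \<Phi>) \<longrightarrow> G (finsert (fill C (fill F \<psi> \<gamma>) \<delta>) \<Phi>)"
    using fill_one_sort(1)[of C]
  proof
    assume "\<forall>\<phi> \<phi>' \<gamma>. fill C \<phi> \<gamma> = fill C \<phi>' \<gamma>"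
    then have "fill C (fill F \<phi> \<gamma>) \<delta> = fill C (fill F \<psi> \<gamma>) \<delta>" by blast
    then show ?thesis by simp
  next
    assume "\<forall>\<phi> \<gamma> \<gamma>'. fill C \<phi> \<gamma> = fill C \<phi> \<gamma>'"
    then have "fill C (fill F \<phi> \<gamma>) \<delta> = fill C (fill F \<phi> \<gamma>) \<gamma>"
      "fill C (fill F \<psi> \<gamma>) \<delta> = fill C (fill F \<psi> \<gamma>) \<gamma>" by blast+
    with step show ?thesis by (simp add: fill_fplug)
  qed
qed

lemma deep_gle_fill:
  assumes "deep_gle \<gamma> \<delta>"
  shows "deep_le (fill F \<phi> \<gamma>) (fill F \<phi> \<delta>)"
  unfolding deep_le_def
proof (intro allI)
  fix C \<epsilon> \<Phi>
  have step: "G (finsert (fill (fplug C F GHole) \<phi> \<gamma>) \<Phi>) \<longrightarrow> G (finsert (fill (fplug C F GHole) \<phi> \<delta>) \<Phi>)"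
    using assms unfolding deep_gle_def by blast
  show "G (finsert (fill C (fill F \<phi> \<gamma>) \<epsilon>) \<Phi>) \<longrightarrow> G (finsert (fill C (fill F \<phi> \<delta>) \<epsilon>) \<Phi>)"
    using fill_one_sort(1)[of C]
  proof
    assume "\<forall>\<phi> \<phi>' \<gamma>. fill C \<phi> \<gamma> = fill C \<phi>' \<gamma>"
    then have "fill C (fill F \<phi> \<gamma>) \<epsilon> = fill C (fill F \<phi> \<delta>) \<epsilon>" by blast
    then show ?thesis by simp
  next
    assume "\<forall>\<phi> \<gamma> \<gamma>'. fill C \<phi> \<gamma> = fill C \<phi> \<gamma>'"
    then have "fill C (fill F \<phi> \<gamma>) \<epsilon> = fill C (fill F \<phi> \<gamma>) \<gamma>"
      "fill C (fill F \<phi> \<delta>) \<epsilon> = fill C (fill F \<phi> \<delta>) \<delta>" by blast+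
    with step show ?thesis by (simp add: fill_fplug)
  qed
qed

lemma deep_gle_gfill:
  assumes "deep_gle \<gamma> \<delta>"
  shows "deep_gle (gfill D \<phi> \<gamma>) (gfill D \<phi> \<delta>)"
  unfolding deep_gle_def
proof (intro allI)
  fix C \<psi> \<Phi>
  have step: "G (finsert (fill (fplug C FHole D) \<phi> \<gamma>) \<Phi>) \<longrightarrow> G (finsert (fill (fplug C FHole D) \<phi> \<delta>) \<Phi>)"
    using assms unfolding deep_gle_def by blast
  show "G (finsert (fill C \<psi> (gfill D \<phi> \<gamma>)) \<Phi>) \<longrightarrow> G (finsert (fill C \<psi> (gfill D \<phi> \<delta>)) \<Phi>)"
    using fill_one_sort(1)[of C]
  proof
    assume "\<forall>\<phi> \<phi>' \<gamma>. fill C \<phi> \<gamma> = fill C \<phi>' \<gamma>"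
    then have "fill C \<psi> (gfill D \<phi> \<gamma>) = fill C \<phi> (gfill D \<phi> \<gamma>)"
      "fill C \<psi> (gfill D \<phi> \<delta>) = fill C \<phi> (gfill D \<phi> \<delta>)" by blast+
    with step show ?thesis by (simp add: fill_fplug)
  next
    assume "\<forall>\<phi> \<gamma> \<gamma>'. fill C \<phi> \<gamma> = fill C \<phi> \<gamma>'"
    then have "fill C \<psi> (gfill D \<phi> \<gamma>) = fill C \<psi> (gfill D \<phi> \<delta>)" by blast
    then show ?thesis by simp
  qed
qed

section \<open>Congruence of deep replacement and its basic instances\<close>

lemma deep_le_Or: "deep_le \<phi> \<phi>' \<Longrightarrow> deep_le \<psi> \<psi>' \<Longrightarrow> deep_le (Or \<phi> \<psi>) (Or \<phi>' \<psi>')"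
  by (rule deep_le_trans[OF deep_le_fill[where F = "OrL FHole _", simplified]
        deep_le_fill[where F = "OrR _ FHole", simplified]])

lemma deep_le_And: "deep_le \<phi> \<phi>' \<Longrightarrow> deep_le \<psi> \<psi>' \<Longrightarrow> deep_le (And \<phi> \<psi>) (And \<phi>' \<psi>')"
  by (rule deep_le_trans[OF deep_le_fill[where F = "AndL FHole _", simplified]
        deep_le_fill[where F = "AndR _ FHole", simplified]])

lemma deep_le_Dia: "deep_gle \<gamma> \<gamma>' \<Longrightarrow> deep_le \<phi> \<phi>' \<Longrightarrow> deep_le (Dia \<gamma> \<phi>) (Dia \<gamma>' \<phi>')"
  by (rule deep_le_trans[OF deep_gle_fill[where F = "DiaL GHole _", simplified]
        deep_le_fill[where F = "DiaR _ FHole", simplified]])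

lemma deep_gle_Seq: "deep_gle \<gamma> \<gamma>' \<Longrightarrow> deep_gle (Seq \<delta> \<gamma>) (Seq \<delta> \<gamma>')"
  using deep_gle_gfill[of \<gamma> \<gamma>' "SeqR \<delta> GHole"] by simp

lemma deep_gle_Cross: "deep_gle \<gamma> \<gamma>' \<Longrightarrow> deep_gle (Cross \<gamma>) (Cross \<gamma>')"
  using deep_gle_gfill[of \<gamma> \<gamma>' "CrossC GHole"] by simp

lemma deep_le_DTest: "deep_le \<phi> (Dia (DTest \<chi>) \<phi>)"
  by (simp add: deep_le_def G_deep_fml)

lemma deep_gle_DTest: "deep_gle \<gamma> (Seq (DTest \<chi>) \<gamma>)"
  by (simp add: deep_gle_def G_deep_game)

lemma deep_le_Seq: "deep_le (Dia \<gamma> (Dia \<delta> \<phi>)) (Dia (Seq \<gamma> \<delta>) \<phi>)"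
  by (simp add: deep_le_def G_deep_seq)

lemma G_seq: "G (finsert (Dia \<gamma> (Dia \<delta> \<phi>)) \<Phi>) \<Longrightarrow> G (finsert (Dia (Seq \<gamma> \<delta>) \<phi>) \<Phi>)"
  using deep_le_Seq by (rule deep_leD)


subsection \<open>Guarding greatest fixpoints\<close>

text \<open>New guards go outermost, as in the conclusion of the induction rule.\<close>

definition guard_game :: "('p, 'g) fml list \<Rightarrow> ('p, 'g) game \<Rightarrow> ('p, 'g) game" where
  "guard_game D \<gamma> = foldl (\<lambda>\<delta> \<chi>. Seq (DTest \<chi>) \<delta>) \<gamma> D"

definition guard_fml :: "('p, 'g) fml list \<Rightarrow> ('p, 'g) fml \<Rightarrow> ('p, 'g) fml" where
  "guard_fml D \<phi> = foldl (\<lambda>\<psi> \<chi>. Dia (DTest \<chi>) \<psi>) \<phi> D"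

lemma guard_game_simps [simp]:
  "guard_game [] \<gamma> = \<gamma>"
  "guard_game (D @ [\<chi>]) \<gamma> = Seq (DTest \<chi>) (guard_game D \<gamma>)"
  by (simp_all add: guard_game_def)

lemma guard_fml_simps [simp]:
  "guard_fml [] \<phi> = \<phi>"
  "guard_fml (D @ [\<chi>]) \<phi> = Dia (DTest \<chi>) (guard_fml D \<phi>)"
  by (simp_all add: guard_fml_def)

lemma deep_gle_guard: "deep_gle \<gamma> (guard_game D \<gamma>)"
  by (induction D rule: rev_induct) (simp_all add: deep_gle_trans[OF _ deep_gle_DTest])

lemma deep_le_guard: "deep_le \<phi> (guard_fml D \<phi>)"
  by (induction D rule: rev_induct) (simp_all add: deep_le_trans[OF _ deep_le_DTest])

text \<open>The last guard is outermost, so induction from the right peels off \<open>D'\<close>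
  until the inserted guard itself is outermost, where one deep rule introduces it.\<close>

lemma deep_gle_guard_insert: "deep_gle (guard_game (D @ D') \<gamma>) (guard_game (D @ \<chi> # D') \<gamma>)"
proof (induction D' rule: rev_induct)
  case (snoc \<eta> D')
  then show ?case
    using guard_game_simps(2)[of "D @ \<chi> # D'" \<eta> \<gamma>] guard_game_simps(2)[of "D @ D'" \<eta> \<gamma>]
    by (simp add: deep_gle_Seq del: guard_game_simps)
qed (simp add: deep_gle_DTest)

lemma deep_le_guard_insert:
  "deep_le \<phi> \<phi>' \<Longrightarrow> deep_le (guard_fml (D @ D') \<phi>) (guard_fml (D @ \<chi> # D') \<phi>')"
proof (induction D' rule: rev_induct)
  case Nil
  have "deep_le (guard_fml D \<phi>) (guard_fml D \<phi>')"
    using Nil by (induction D rule: rev_induct) (auto intro: deep_le_Dia)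
  then show ?case by (simp_all add: deep_le_trans[OF _ deep_le_DTest])
next
  case (snoc \<eta> D')
  then show ?case
    using guard_fml_simps(2)[of "D @ \<chi> # D'" \<eta> \<phi>'] guard_fml_simps(2)[of "D @ D'" \<eta> \<phi>]
    by (simp add: deep_le_Dia del: guard_fml_simps)
qed

lemma deep_le_guard_mono: "deep_le \<phi> \<phi>' \<Longrightarrow> deep_le (guard_fml D \<phi>) (guard_fml D \<phi>')"
  by (induction D rule: rev_induct) (auto intro: deep_le_Dia)


subsection \<open>Translating annotated formulas\<close>

text \<open>Total, so that \<open>translate\<close> has one clause for \<open>Dia\<close>. Owners of
  names are greatest fixpoints, so for other games \<open>translate\<close> passes the empty
  list.\<close>

fun guard_cross :: "('p, 'g) fml list \<Rightarrow> ('p, 'g) game \<Rightarrow> ('p, 'g) game" where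
  "guard_cross D (Cross \<gamma>) = Cross (guard_game D \<gamma>)"
| "guard_cross D \<gamma> = \<gamma>"

text \<open>The order of names is kept: the name that the closure rule appends becomes the last,
  hence outermost, guard.\<close>

definition guards ::
  "(('p, 'g) name \<Rightarrow> ('p, 'g) fml) \<Rightarrow> ('p, 'g) name list \<Rightarrow> ('p, 'g) fml \<Rightarrow> ('p, 'g) fml list"
where
  "guards E a \<theta> = map E (filter (\<lambda>x. owner x = \<theta>) a)"

text \<open>Only greatest fixpoints on the spine of a formula are guarded, not those
  inside a game: the rules never bring such a fixpoint to the spine as the owner
  of a name that the formula still carries (\<open>descends\<close> below).\<close>

primrec translate ::
  "(('p, 'g) name \<Rightarrow> ('p, 'g) fml) \<Rightarrow> ('p, 'g) name list \<Rightarrow> ('p, 'g) fml \<Rightarrow> ('p, 'g) fml"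
where
  "translate E a (Pos p) = Pos p"
| "translate E a (Neg p) = Neg p"
| "translate E a (Or \<phi> \<psi>) = Or (translate E a \<phi>) (translate E a \<psi>)"
| "translate E a (And \<phi> \<psi>) = And (translate E a \<phi>) (translate E a \<psi>)"
| "translate E a (Dia \<gamma> \<phi>) =
     Dia (guard_cross (guards E a (Dia \<gamma> \<phi>)) \<gamma>) (guard_fml (guards E a (Dia \<gamma> \<phi>)) (translate E a \<phi>))"

lemma guard_cross_Nil [simp]: "guard_cross [] \<gamma> = \<gamma>"
  by (cases \<gamma>) simp_all

lemma guards_eq_Nil: "\<theta> \<notin> owner ` set a \<Longrightarrow> guards E a \<theta> = []"
  by (auto simp: guards_def filter_empty_conv)

lemma owner_eq_Dia: "owner x = Dia \<gamma> \<phi> \<Longrightarrow> \<exists>\<delta>. \<gamma> = Cross \<delta>"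
  by (cases x) auto

lemma guards_not_Cross: "(\<And>\<delta>. \<gamma> \<noteq> Cross \<delta>) \<Longrightarrow> guards E a (Dia \<gamma> \<phi>) = []"
  by (rule guards_eq_Nil) (metis imageE owner_eq_Dia)

lemma translate_Nil [simp]: "translate E [] \<phi> = \<phi>"
  by (induction \<phi> rule: fml.induct[where ?P2.0 = "\<lambda>_. True"]) (simp_all add: guards_def)

lemma translate_cong: "(\<And>x. x \<in> set a \<Longrightarrow> E x = E' x) \<Longrightarrow> translate E a \<phi> = translate E' a \<phi>"
proof -
  assume "\<And>x. x \<in> set a \<Longrightarrow> E x = E' x"
  then have "guards E a \<theta> = guards E' a \<theta>" for \<theta> by (auto simp: guards_def)
  then show ?thesis
    by (induction \<phi> rule: fml.induct[where ?P2.0 = "\<lambda>_. True"]) simp_all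
qed

text \<open>A guard from \<open>x\<close> appears only at an occurrence of its owner, and a smaller
  formula contains none.\<close>

lemma translate_snoc_small: "size \<phi> < size (owner x) \<Longrightarrow> translate E (a @ [x]) \<phi> = translate E a \<phi>"
  by (induction \<phi> rule: fml.induct[where ?P2.0 = "\<lambda>_. True"]) (auto simp: guards_def)

lemma translate_small: "(\<And>x. x \<in> set a \<Longrightarrow> size \<phi> < size (owner x)) \<Longrightarrow> translate E a \<phi> = \<phi>"
  by (induction a rule: rev_induct) (simp_all add: translate_snoc_small)

text \<open>Justifies the rule that drops a name upwards: read towards the conclusion, it inserts
  one guard at each spine occurrence of the owner.\<close>

lemma deep_le_translate_insert: "deep_le (translate E (a @ b) \<phi>) (translate E (a @ x # b) \<phi>)"
proof (induction \<phi> rule: fml.induct[where ?P2.0 = "\<lambda>_. True"])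
  case (Dia \<gamma> \<phi>)
  show ?case
  proof (cases "owner x = Dia \<gamma> \<phi>")
    case True
    then obtain \<delta> where "\<gamma> = Cross \<delta>" using owner_eq_Dia by blast
    with True Dia show ?thesis
      by (auto simp: guards_def
          intro!: deep_le_Dia deep_gle_Cross deep_gle_guard_insert deep_le_guard_insert)
  next
    case False
    with Dia show ?thesis
      by (auto simp: guards_def intro!: deep_le_Dia deep_le_guard_mono)
  qed
qed (auto intro: deep_le_Or deep_le_And)


subsection \<open>Descendants of a fixpoint formula\<close>

text \<open>An overapproximation of the formulas above \<open>\<langle>\<alpha>\<^sup>\<times>\<rangle>\<phi>\<close> in a derivation that
  still carry one of its names.\<close>

inductive descends :: "('p, 'g) game \<Rightarrow> ('p, 'g) fml \<Rightarrow> ('p, 'g) fml \<Rightarrow> bool" for \<alpha> \<phi> where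
  self: "descends \<alpha> \<phi> (Dia (Cross \<alpha>) \<phi>)"
| small: "size \<psi> < size (Dia (Cross \<alpha>) \<phi>) \<Longrightarrow> descends \<alpha> \<phi> \<psi>"
| Or: "descends \<alpha> \<phi> \<psi> \<Longrightarrow> descends \<alpha> \<phi> \<chi> \<Longrightarrow> descends \<alpha> \<phi> (Or \<psi> \<chi>)"
| And: "descends \<alpha> \<phi> \<psi> \<Longrightarrow> descends \<alpha> \<phi> \<chi> \<Longrightarrow> descends \<alpha> \<phi> (And \<psi> \<chi>)"
| Dia: "size \<delta> < size (Cross \<alpha>) \<Longrightarrow> descends \<alpha> \<phi> \<psi> \<Longrightarrow> descends \<alpha> \<phi> (Dia \<delta> \<psi>)"

lemma descends_Or_iff: "descends \<alpha> \<phi> (Or \<psi> \<chi>) \<longleftrightarrow> descends \<alpha> \<phi> \<psi> \<and> descends \<alpha> \<phi> \<chi>"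
  by (rule iffI, erule descends.cases) (simp_all add: descends.small descends.Or)

lemma descends_And_iff: "descends \<alpha> \<phi> (And \<psi> \<chi>) \<longleftrightarrow> descends \<alpha> \<phi> \<psi> \<and> descends \<alpha> \<phi> \<chi>"
  by (rule iffI, erule descends.cases) (simp_all add: descends.small descends.And)

lemma descends_DiaD: "descends \<alpha> \<phi> (Dia \<gamma> \<psi>) \<Longrightarrow> descends \<alpha> \<phi> \<psi>"
  by (erule descends.cases) (simp_all add: descends.small)

lemma descends_Dia_cases:
  assumes "descends \<alpha> \<phi> (Dia \<gamma> \<psi>)" "\<gamma> \<noteq> Cross \<alpha>"
  obtains "size (Dia \<gamma> \<psi>) < size (Dia (Cross \<alpha>) \<phi>)"
    | "size \<gamma> < size (Cross \<alpha>)" "descends \<alpha> \<phi> \<psi>"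
  using assms(1) by (cases rule: descends.cases) (use assms(2) that in auto)

text \<open>Either the whole formula is smaller than the owner, or its head game is smaller than
  \<open>Cross \<alpha>\<close>. Both bounds pass to the component games, and both exclude the
  owner.\<close>

lemma descends_Cup_Cap:
  assumes "descends \<alpha> \<phi> (Dia \<beta> \<psi>)" "\<beta> = Cup \<gamma> \<delta> \<or> \<beta> = Cap \<gamma> \<delta>"
  shows "descends \<alpha> \<phi> (Dia \<gamma> \<psi>) \<and> descends \<alpha> \<phi> (Dia \<delta> \<psi>) \<and>
    Dia \<gamma> \<psi> \<noteq> Dia (Cross \<alpha>) \<phi> \<and> Dia \<delta> \<psi> \<noteq> Dia (Cross \<alpha>) \<phi>"
  using assms(1)
proof (rule descends_Dia_cases)
  show "\<beta> \<noteq> Cross \<alpha>" using assms(2) by auto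
next
  assume "size (Dia \<beta> \<psi>) < size (Dia (Cross \<alpha>) \<phi>)"
  with assms(2) have "size (Dia \<gamma> \<psi>) < size (Dia (Cross \<alpha>) \<phi>)"
    "size (Dia \<delta> \<psi>) < size (Dia (Cross \<alpha>) \<phi>)" by auto
  then show ?thesis by (metis descends.small less_irrefl)
next
  assume "size \<beta> < size (Cross \<alpha>)" "descends \<alpha> \<phi> \<psi>"
  with assms(2) have "size \<gamma> < size (Cross \<alpha>)" "size \<delta> < size (Cross \<alpha>)" by auto
  with \<open>descends \<alpha> \<phi> \<psi>\<close> show ?thesis by (metis descends.Dia fml.inject(5) less_irrefl)
qed

lemma descends_Seq:
  assumes "descends \<alpha> \<phi> (Dia (Seq \<gamma> \<delta>) \<psi>)"
  shows "descends \<alpha> \<phi> (Dia \<gamma> (Dia \<delta> \<psi>)) \<and>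
    Dia \<gamma> (Dia \<delta> \<psi>) \<noteq> Dia (Cross \<alpha>) \<phi> \<and> Dia \<delta> \<psi> \<noteq> Dia (Cross \<alpha>) \<phi>"
  using assms
proof (rule descends_Dia_cases)
  assume "size (Dia (Seq \<gamma> \<delta>) \<psi>) < size (Dia (Cross \<alpha>) \<phi>)"
  \<comment> \<open>Splitting the composition regroups the term without changing its size.\<close>
  then have "size (Dia \<gamma> (Dia \<delta> \<psi>)) < size (Dia (Cross \<alpha>) \<phi>)"
    "size (Dia \<delta> \<psi>) < size (Dia (Cross \<alpha>) \<phi>)" by auto
  then show ?thesis by (metis descends.small less_irrefl)
next
  assume "size (Seq \<gamma> \<delta>) < size (Cross \<alpha>)" "descends \<alpha> \<phi> \<psi>"
  moreover from this have "size \<gamma> < size (Cross \<alpha>)" "size \<delta> < size (Cross \<alpha>)" by auto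
  ultimately show ?thesis by (metis descends.Dia fml.inject(5) less_irrefl)
qed simp

lemma size_subgames:
  fixes \<phi> :: "('p, 'g) fml" and \<gamma> :: "('p, 'g) game"
  shows "\<delta> \<in> fsubgames \<phi> \<Longrightarrow> size \<delta> < size \<phi>"
    and "\<delta> \<in> subgames \<gamma> \<Longrightarrow> \<delta> = \<gamma> \<or> size \<delta> < size \<gamma>"
  by (induction \<phi> and \<gamma>) auto

text \<open>The subterm condition bounds \<open>\<beta>\<close> by the size of
  \<open>Cross \<alpha>\<close>, so its body \<open>\<gamma>\<close> is strictly smaller. Unfolding
  thus puts a small game in front of a formula that already descends.\<close>

lemma descends_fixpoint:
  assumes "descends \<alpha> \<phi> (Dia \<beta> \<psi>)" "\<beta> \<in> subgames (Cross \<alpha>)" "\<beta> = Star \<gamma> \<or> \<beta> = Cross \<gamma>"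
  shows "descends \<alpha> \<phi> \<psi> \<and> descends \<alpha> \<phi> (Dia \<gamma> (Dia \<beta> \<psi>)) \<and>
    Dia \<gamma> (Dia \<beta> \<psi>) \<noteq> Dia (Cross \<alpha>) \<phi>"
proof -
  have "size \<gamma> < size (Cross \<alpha>)"
    using size_subgames(2)[OF assms(2)] assms(3) by auto
  then show ?thesis
    using descends_DiaD[OF assms(1)] descends.Dia[OF _ assms(1)] by auto
qed

lemma descends_Test:
  assumes "descends \<alpha> \<phi> (Dia \<beta> \<psi>)" "\<beta> = Test \<chi> \<or> \<beta> = DTest \<chi>"
  shows "size \<chi> < size (Dia (Cross \<alpha>) \<phi>) \<and> descends \<alpha> \<phi> \<psi>"
  using assms(1)
proof (rule descends_Dia_cases)
  show "\<beta> \<noteq> Cross \<alpha>" using assms(2) by auto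
qed (use assms(2) in \<open>auto intro: descends.small\<close>)


subsection \<open>The embedding\<close>

text \<open>\<open>N\<close> will be the domain of the open assumptions, so that every name carried
  is bound by a closure further down.\<close>

definition admissible :: "('p, 'g) name set \<Rightarrow> ('p, 'g) name list \<Rightarrow> ('p, 'g) fml \<Rightarrow> bool" where
  "admissible N a \<psi> \<longleftrightarrow>
     set a \<subseteq> N \<and> (\<forall>x\<in>set a. \<forall>\<alpha> \<phi>. owner x = Dia (Cross \<alpha>) \<phi> \<longrightarrow> descends \<alpha> \<phi> \<psi>)"

lemma admissible_weaken_names: "admissible N a \<psi> \<Longrightarrow> N \<subseteq> N' \<Longrightarrow> admissible N' a \<psi>"
  by (auto simp: admissible_def)

lemma admissible_Or: "admissible N a (Or \<psi> \<chi>) \<longleftrightarrow> admissible N a \<psi> \<and> admissible N a \<chi>"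
  by (auto simp: admissible_def descends_Or_iff)

lemma admissible_And: "admissible N a (And \<psi> \<chi>) \<longleftrightarrow> admissible N a \<psi> \<and> admissible N a \<chi>"
  by (auto simp: admissible_def descends_And_iff)

lemma admissible_DiaD: "admissible N a (Dia \<gamma> \<psi>) \<Longrightarrow> admissible N a \<psi>"
  using descends_DiaD unfolding admissible_def by blast

section \<open>Admissibility and translation under the game rules\<close>

lemma translate_unguarded:
  "Dia \<gamma> \<phi> \<notin> owner ` set a \<Longrightarrow> translate E a (Dia \<gamma> \<phi>) = Dia \<gamma> (translate E a \<phi>)"
  by (simp add: guards_eq_Nil)

lemma translate_not_Cross:
  "(\<And>\<delta>. \<gamma> \<noteq> Cross \<delta>) \<Longrightarrow> translate E a (Dia \<gamma> \<phi>) = Dia \<gamma> (translate E a \<phi>)"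
  by (simp add: guards_not_Cross)

lemma not_ownerI:
  assumes "\<And>x \<alpha> \<phi>. x \<in> set a \<Longrightarrow> owner x = Dia (Cross \<alpha>) \<phi> \<Longrightarrow> \<theta> \<noteq> Dia (Cross \<alpha>) \<phi>"
  shows "\<theta> \<notin> owner ` set a"
proof
  assume "\<theta> \<in> owner ` set a"
  then obtain x where "x \<in> set a" "\<theta> = owner x" by blast
  with assms show False by (cases x) (metis owner.simps)
qed

text \<open>Neither new formula owns a name in \<open>a\<close>, so no guard arises at the head and
  translation commutes with the rule.\<close>

lemma admissible_Cup_Cap:
  assumes "admissible N a (Dia \<beta> \<psi>)" "\<beta> = Cup \<gamma> \<delta> \<or> \<beta> = Cap \<gamma> \<delta>"
  shows "admissible N a (Dia \<gamma> \<psi>) \<and> admissible N a (Dia \<delta> \<psi>) \<and>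
    translate E a (Dia \<gamma> \<psi>) = Dia \<gamma> (translate E a \<psi>) \<and>
    translate E a (Dia \<delta> \<psi>) = Dia \<delta> (translate E a \<psi>)"
proof -
  have desc: "descends \<alpha> \<phi> (Dia \<gamma> \<psi>) \<and> descends \<alpha> \<phi> (Dia \<delta> \<psi>) \<and>
      Dia \<gamma> \<psi> \<noteq> Dia (Cross \<alpha>) \<phi> \<and> Dia \<delta> \<psi> \<noteq> Dia (Cross \<alpha>) \<phi>"
    if "x \<in> set a" "owner x = Dia (Cross \<alpha>) \<phi>" for x \<alpha> \<phi>
    using descends_Cup_Cap[OF _ assms(2)] assms(1) that unfolding admissible_def by blast
  have "Dia \<gamma> \<psi> \<notin> owner ` set a" "Dia \<delta> \<psi> \<notin> owner ` set a"
    using desc by (blast intro!: not_ownerI)+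
  moreover have "admissible N a (Dia \<gamma> \<psi>) \<and> admissible N a (Dia \<delta> \<psi>)"
    using desc assms(1) unfolding admissible_def by blast
  ultimately show ?thesis by (simp add: translate_unguarded del: translate.simps)
qed

lemma admissible_Seq:
  assumes "admissible N a (Dia (Seq \<gamma> \<delta>) \<psi>)"
  shows "admissible N a (Dia \<gamma> (Dia \<delta> \<psi>)) \<and>
    translate E a (Dia \<gamma> (Dia \<delta> \<psi>)) = Dia \<gamma> (Dia \<delta> (translate E a \<psi>))"
proof -
  have desc: "descends \<alpha> \<phi> (Dia \<gamma> (Dia \<delta> \<psi>)) \<and>
      Dia \<gamma> (Dia \<delta> \<psi>) \<noteq> Dia (Cross \<alpha>) \<phi> \<and> Dia \<delta> \<psi> \<noteq> Dia (Cross \<alpha>) \<phi>"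
    if "x \<in> set a" "owner x = Dia (Cross \<alpha>) \<phi>" for x \<alpha> \<phi>
    using descends_Seq assms that unfolding admissible_def by blast
  have "Dia \<gamma> (Dia \<delta> \<psi>) \<notin> owner ` set a" "Dia \<delta> \<psi> \<notin> owner ` set a"
    using desc by (blast intro!: not_ownerI)+
  moreover have "admissible N a (Dia \<gamma> (Dia \<delta> \<psi>))"
    using desc assms unfolding admissible_def by blast
  ultimately show ?thesis by (simp add: translate_unguarded del: translate.simps)
qed

text \<open>The tested formula is smaller than every owner in \<open>a\<close>. It stays
  untranslated, in agreement with \<open>translate\<close> leaving the inside of games
  alone.\<close>

lemma admissible_Test:
  assumes "admissible N a (Dia \<beta> \<psi>)" "\<beta> = Test \<chi> \<or> \<beta> = DTest \<chi>"
  shows "admissible N a \<chi> \<and> admissible N a \<psi> \<and> translate E a \<chi> = \<chi>"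
proof -
  have desc: "size \<chi> < size (Dia (Cross \<alpha>) \<phi>) \<and> descends \<alpha> \<phi> \<psi>"
    if "x \<in> set a" "owner x = Dia (Cross \<alpha>) \<phi>" for x \<alpha> \<phi>
    using descends_Test[OF _ assms(2)] assms(1) that by (auto simp: admissible_def)
  have "translate E a \<chi> = \<chi>"
  proof (rule translate_small)
    show "size \<chi> < size (owner x)" if "x \<in> set a" for x
      using desc[OF that] by (cases x) auto
  qed
  then show ?thesis
    using desc assms(1) unfolding admissible_def by (blast intro: descends.small)
qed

text \<open>\<open>ann_le\<close> makes the fixpoint game a subterm of every owner's game, as
  \<open>descends_fixpoint\<close> requires. The unfolding is unguarded at its head, while
  \<open>Dia \<beta> \<psi>\<close> behind \<open>\<gamma>\<close> keeps its guards.\<close>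

lemma admissible_fixpoint:
  assumes "admissible N a (Dia \<beta> \<psi>)" "ann_le a (Dia \<beta> \<psi>)" "\<beta> = Star \<gamma> \<or> \<beta> = Cross \<gamma>"
  shows "admissible N a \<psi> \<and> admissible N a (Dia \<gamma> (Dia \<beta> \<psi>)) \<and>
    Dia \<gamma> (Dia \<beta> \<psi>) \<notin> owner ` set a \<and>
    translate E a (Dia \<gamma> (Dia \<beta> \<psi>)) = Dia \<gamma> (translate E a (Dia \<beta> \<psi>))"
proof -
  have desc: "descends \<alpha> \<phi> \<psi> \<and> descends \<alpha> \<phi> (Dia \<gamma> (Dia \<beta> \<psi>)) \<and> Dia \<gamma> (Dia \<beta> \<psi>) \<noteq> Dia (Cross \<alpha>) \<phi>"
    if "x \<in> set a" "owner x = Dia (Cross \<alpha>) \<phi>" for x \<alpha> \<phi>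
  proof (rule descends_fixpoint[OF _ _ assms(3)])
    show "descends \<alpha> \<phi> (Dia \<beta> \<psi>)" using assms(1) that by (auto simp: admissible_def)
    show "\<beta> \<in> subgames (Cross \<alpha>)" using assms(2) that by (auto simp: ann_le_def le_fp_def)
  qed
  then have "Dia \<gamma> (Dia \<beta> \<psi>) \<notin> owner ` set a" by (blast intro!: not_ownerI)
  moreover have "admissible N a \<psi> \<and> admissible N a (Dia \<gamma> (Dia \<beta> \<psi>))"
    using desc assms(1) unfolding admissible_def by blast
  ultimately show ?thesis by (simp add: translate_unguarded del: translate.simps)
qed

lemma admissible_Nil [simp]: "admissible N [] \<psi>"
  by (simp add: admissible_def)

section \<open>Translated sequents and the reading of open assumptions\<close>

definition translate_seq ::
  "(('p, 'g) name \<Rightarrow> ('p, 'g) fml) \<Rightarrow> ('p, 'g) afml fset \<Rightarrow> ('p, 'g) fml fset"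
where
  "translate_seq E \<Phi> = (\<lambda>(\<phi>, a). translate E a \<phi>) |`| \<Phi>"

lemma translate_seq_simps [simp]:
  "translate_seq E {||} = {||}"
  "translate_seq E (finsert (\<phi>, a) \<Phi>) = finsert (translate E a \<phi>) (translate_seq E \<Phi>)"
  by (simp_all add: translate_seq_def)

lemma translate_seq_upd:
  "\<forall>(\<psi>, b)\<in>fset \<Phi>. x \<notin> set b \<Longrightarrow> translate_seq (E(x := \<chi>)) \<Phi> = translate_seq E \<Phi>"
  unfolding translate_seq_def by (rule fset.map_cong0) (fastforce intro: translate_cong)

definition admissible_seq :: "('p, 'g) name set \<Rightarrow> ('p, 'g) afml fset \<Rightarrow> bool" where
  "admissible_seq N \<Phi> \<longleftrightarrow> (\<forall>(\<phi>, a)\<in>fset \<Phi>. admissible N a \<phi>)"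

lemma admissible_seq_simps [simp]:
  "admissible_seq N {||}"
  "admissible_seq N (finsert (\<phi>, a) \<Phi>) \<longleftrightarrow> admissible N a \<phi> \<and> admissible_seq N \<Phi>"
  by (simp_all add: admissible_seq_def)

lemma admissible_seq_weaken_names: "admissible_seq N \<Phi> \<Longrightarrow> N \<subseteq> N' \<Longrightarrow> admissible_seq N' \<Phi>"
  unfolding admissible_seq_def by (auto intro: admissible_weaken_names)

text \<open>The last clause restricts stored sequents to bound names, so that interpreting a fresh
  name preserves their translations and the equations for \<open>E\<close>.\<close>

definition interprets ::
  "(('p, 'g) name \<Rightarrow> ('p, 'g) fml) \<Rightarrow> (('p, 'g) name \<rightharpoonup> ('p, 'g) afml fset) \<Rightarrow> bool"
where
  "interprets E H \<longleftrightarrow> (\<forall>x \<Gamma>. H x = Some \<Gamma> \<longrightarrow>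
     (\<exists>\<gamma> \<phi> a \<Phi>. \<Gamma> = finsert (Dia (Cross \<gamma>) \<phi>, a @ [x]) \<Phi> \<and> owner x = Dia (Cross \<gamma>) \<phi> \<and>
       E x = seq_compl (translate_seq E \<Phi>) \<and> admissible_seq (dom H) \<Gamma>))"

lemma guards_snoc_owner: "owner x = \<theta> \<Longrightarrow> guards E (a @ [x]) \<theta> = guards E a \<theta> @ [E x]"
  by (simp add: guards_def)

text \<open>The translation of a discharged assumption, whose outermost guard comes from
  the discharged name.\<close>

lemma G_guarded_cross:
  "G (finsert (Dia (Cross (Seq (DTest (seq_compl \<Phi>)) \<gamma>)) (Dia (DTest (seq_compl \<Phi>)) \<phi>)) \<Phi>)"
proof (rule G_cross, rule G_and)
  \<comment> \<open>The guard unfolds to a disjunction containing \<open>seq_compl \<Phi>\<close>,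
    which the axiom and a weakening derive. Both conjuncts of the unfolding start with this
    guard.\<close>
  have test: "G (finsert (Dia (DTest (seq_compl \<Phi>)) \<psi>) \<Phi>)" for \<psi>
    using G_weak[OF G_ax[of \<Phi>], of \<psi>] by (intro G_dtest G_or) (simp add: finsert_commute)
  then show "G (finsert (Dia (DTest (seq_compl \<Phi>)) \<phi>) \<Phi>)"
    and "G (finsert (Dia (Seq (DTest (seq_compl \<Phi>)) \<gamma>) \<psi>) \<Phi>)" for \<psi>
    by (auto intro: G_seq)
qed

text \<open>The enumeration behind \<open>seq_compl\<close> is picked by choice, but a singleton has
  only one. This makes the literal axiom an instance of \<open>G_ax\<close>.\<close>

lemma seq_compl_singleton: "seq_compl {|\<phi>|} = compl \<phi>"
proof -
  have "distinct \<phi>s \<and> fset_of_list \<phi>s = {|\<phi>|} \<longleftrightarrow> \<phi>s = [\<phi>]" for \<phi>s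
  proof
    assume *: "distinct \<phi>s \<and> fset_of_list \<phi>s = {|\<phi>|}"
    then have "set \<phi>s = {\<phi>}" by (metis fset_of_list.rep_eq bot_fset.rep_eq finsert.rep_eq)
    with * show "\<phi>s = [\<phi>]"
      by (cases \<phi>s) (auto simp: subset_singleton_iff)
  qed simp
  then show ?thesis by (simp add: seq_compl_def)
qed

text \<open>The induction needs open assumptions: a leaf awaiting discharge becomes derivable once
  its label is read through \<open>E\<close>. The interpretation varies because each closure extends
  it.\<close>

lemma Clo_imp_G_translate:
  "Clo H \<Gamma> \<Longrightarrow> interprets E H \<Longrightarrow> admissible_seq (dom H) \<Gamma> \<Longrightarrow> G (translate_seq E \<Gamma>)"
proof (induction arbitrary: E rule: Clo.induct)
  case (Clo_hyp H x \<Gamma>)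
  then obtain \<gamma> \<phi> a \<Phi> where \<Gamma>: "\<Gamma> = finsert (Dia (Cross \<gamma>) \<phi>, a @ [x]) \<Phi>"
    and x: "owner x = Dia (Cross \<gamma>) \<phi>" "E x = seq_compl (translate_seq E \<Phi>)"
    unfolding interprets_def by meson
  show ?case
    using G_guarded_cross[of "translate_seq E \<Phi>"]
    by (simp add: \<Gamma> guards_snoc_owner[OF x(1)] x(2))
next
  case (Clo_ax H)
  show ?case
    using G_ax[of "{|Pos p|}" for p] by (simp add: seq_compl_singleton finsert_commute)
next
  case (Clo_or H \<phi> a \<psi> \<Phi>)
  then show ?case by (simp add: admissible_Or G_or)
next
  case (Clo_and H \<phi> a \<Phi> \<psi>)
  then show ?case by (simp add: admissible_And G_and)
next
  case (Clo_mod H \<phi> a \<psi> b g)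
  then have "G (translate_seq E {|(\<phi>, a), (\<psi>, b)|})"
    by (auto dest: admissible_DiaD)
  then show ?case by (simp add: guards_not_Cross G_mod)
next
  case (Clo_cup H \<gamma> \<phi> \<delta> a \<Phi>)
  then have "admissible (dom H) a (Dia (Cup \<gamma> \<delta>) \<phi>)" by simp
  note step = admissible_Cup_Cap[OF this, of \<gamma> \<delta> E]
  show ?case
    using Clo_cup.IH[OF Clo_cup.prems(1)] Clo_cup.prems(2) step
    by (simp add: translate_not_Cross admissible_Or G_cup del: translate.simps(5))
next
  case (Clo_cap H \<gamma> \<phi> \<delta> a \<Phi>)
  then have "admissible (dom H) a (Dia (Cap \<gamma> \<delta>) \<phi>)" by simp
  note step = admissible_Cup_Cap[OF this, of \<gamma> \<delta> E]
  show ?case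
    using Clo_cap.IH[OF Clo_cap.prems(1)] Clo_cap.prems(2) step
    by (simp add: translate_not_Cross admissible_And G_cap del: translate.simps(5))
next
  case (Clo_weak H \<Phi> a \<phi>)
  then show ?case by (simp add: G_weak)
next
  case (Clo_exp H \<phi> a b \<Phi> x)
  then have "G (translate_seq E (finsert (\<phi>, a @ b) \<Phi>))"
    by (auto simp: admissible_def)
  then show ?case by (auto intro: deep_leD[OF deep_le_translate_insert])
next
  case (Clo_seq H \<gamma> \<delta> \<phi> a \<Phi>)
  then have "admissible (dom H) a (Dia (Seq \<gamma> \<delta>) \<phi>)" by simp
  note step = admissible_Seq[OF this, of E]
  show ?case
    using Clo_seq.IH[OF Clo_seq.prems(1)] Clo_seq.prems(2) step
    by (simp add: translate_not_Cross G_seq del: translate.simps(5))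
next
  case (Clo_star H \<phi> \<gamma> a \<Phi>)
  then have "admissible (dom H) a (Dia (Star \<gamma>) \<phi>)" by simp
  note step = admissible_fixpoint[OF this \<open>ann_le a (Dia (Star \<gamma>) \<phi>)\<close>, of \<gamma> E]
  show ?case
    using Clo_star.IH[OF Clo_star.prems(1)] Clo_star.prems(2) step
    by (simp add: translate_not_Cross admissible_Or G_star del: translate.simps(5))
next
  case (Clo_cross H \<phi> \<gamma> a \<Phi>)
  let ?D = "guards E a (Dia (Cross \<gamma>) \<phi>)"
  have "admissible (dom H) a (Dia (Cross \<gamma>) \<phi>)" using Clo_cross by simp
  note fp = admissible_fixpoint[OF this \<open>ann_le a (Dia (Cross \<gamma>) \<phi>)\<close>, of \<gamma> E]
  have "G (finsert (And (translate E a \<phi>) (Dia \<gamma> (translate E a (Dia (Cross \<gamma>) \<phi>))))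
      (translate_seq E \<Phi>))"
    using Clo_cross.IH[OF Clo_cross.prems(1)] Clo_cross.prems(2) fp
    by (simp add: admissible_And del: translate.simps(5))
  \<comment> \<open>\<open>G_cross\<close> for the guarded fixpoint expects guards on
    \<open>\<phi>\<close> and on the head game \<open>\<gamma>\<close>; deep inference inserts
    both.\<close>
  from deep_leD[OF deep_le_And[OF deep_le_guard deep_le_Dia[OF deep_gle_guard deep_le_refl]] this]
  have "G (finsert (And (guard_fml ?D (translate E a \<phi>))
      (Dia (guard_game ?D \<gamma>) (translate E a (Dia (Cross \<gamma>) \<phi>)))) (translate_seq E \<Phi>))" .
  then show ?case by (simp add: G_cross)
next
  case (Clo_test H \<psi> \<phi> a \<Phi>)
  then have "admissible (dom H) a (Dia (Test \<psi>) \<phi>)" by simp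
  note step = admissible_Test[OF this, of \<psi> E]
  show ?case
    using Clo_test.IH[OF Clo_test.prems(1)] Clo_test.prems(2) step
    by (simp add: translate_not_Cross admissible_And G_test del: translate.simps(5))
next
  case (Clo_dtest H \<psi> \<phi> a \<Phi>)
  then have "admissible (dom H) a (Dia (DTest \<psi>) \<phi>)" by simp
  note step = admissible_Test[OF this, of \<psi> E]
  show ?case
    using Clo_dtest.IH[OF Clo_dtest.prems(1)] Clo_dtest.prems(2) step
    by (simp add: translate_not_Cross admissible_Or G_dtest del: translate.simps(5))
next
  case (Clo_clo H x \<gamma> \<phi> a \<Phi>)
  let ?\<theta> = "Dia (Cross \<gamma>) \<phi>"
  let ?D = "guards E a ?\<theta>" and ?\<Phi> = "translate_seq E \<Phi>"
  let ?\<chi> = "seq_compl ?\<Phi>"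
  let ?E = "E(x := ?\<chi>)" and ?H = "H(x \<mapsto> finsert (?\<theta>, a @ [x]) \<Phi>)"
  have owner: "owner x = ?\<theta>" using \<open>x \<in> names ?\<theta>\<close> by (simp add: names_def)
  have adm: "admissible (dom H) a ?\<theta>" "admissible_seq (dom H) \<Phi>" using Clo_clo.prems by simp_all
  have "ann_le a ?\<theta>"
    using \<open>\<forall>y\<in>set a. name_le y x\<close> owner by (simp add: ann_le_def name_le_def)
  note fp = admissible_fixpoint[OF adm(1) this, of \<gamma>]
  \<comment> \<open>Admissibility confines the names of \<open>\<Psi>\<close> to
    \<open>dom H\<close>, and the label convention keeps \<open>x\<close> out of it, so giving
    \<open>x\<close> a value does not disturb older readings.\<close>
  have upd: "translate_seq ?E \<Psi> = translate_seq E \<Psi>" if "admissible_seq (dom H) \<Psi>" for \<Psi>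
    using that \<open>x \<notin> dom H\<close> by (intro translate_seq_upd) (auto simp: admissible_seq_def admissible_def)
  have a_upd: "translate ?E a \<psi> = translate E a \<psi>" for \<psi>
    using \<open>x \<notin> set a\<close> by (intro translate_cong) auto
  have adm': "admissible (dom ?H) (a @ [x]) \<psi>"
    if "admissible (dom H) a \<psi>" "descends \<gamma> \<phi> \<psi>" for \<psi>
    using that owner by (auto simp: admissible_def)
  have new: "admissible_seq (dom ?H) (finsert (?\<theta>, a @ [x]) \<Phi>)"
    using adm adm'[OF adm(1) descends.self] by (auto intro: admissible_seq_weaken_names)
  have unfolded: "descends \<gamma> \<phi> (And \<phi> (Dia \<gamma> ?\<theta>))"
    by (auto intro!: descends.And descends.Dia descends.self intro: descends.small)
  have "interprets ?E ?H"
    unfolding interprets_def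
  proof (intro allI impI)
    fix y \<Gamma>
    assume y: "?H y = Some \<Gamma>"
    show "\<exists>\<gamma> \<phi> a \<Psi>. \<Gamma> = finsert (Dia (Cross \<gamma>) \<phi>, a @ [y]) \<Psi> \<and> owner y = Dia (Cross \<gamma>) \<phi> \<and>
       ?E y = seq_compl (translate_seq ?E \<Psi>) \<and> admissible_seq (dom ?H) \<Gamma>"
    proof (cases "y = x")
      case True
      with y new owner upd[OF adm(2)] show ?thesis
        by (intro exI[of _ \<gamma>] exI[of _ \<phi>] exI[of _ a] exI[of _ \<Phi>]) simp
    next
      case False
      with y have "H y = Some \<Gamma>" by simp
      then obtain \<delta> \<psi> b \<Psi> where \<Gamma>: "\<Gamma> = finsert (Dia (Cross \<delta>) \<psi>, b @ [y]) \<Psi>"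
        and "owner y = Dia (Cross \<delta>) \<psi>" "E y = seq_compl (translate_seq E \<Psi>)"
        and "admissible_seq (dom H) \<Gamma>"
        using \<open>interprets E H\<close> unfolding interprets_def by meson
      moreover have "admissible_seq (dom ?H) \<Gamma>"
        using \<open>admissible_seq (dom H) \<Gamma>\<close> by (rule admissible_seq_weaken_names) auto
      ultimately show ?thesis
        using False upd[of \<Psi>] by (intro exI[of _ \<delta>] exI[of _ \<psi>] exI[of _ b] exI[of _ \<Psi>]) simp
    qed
  qed
  moreover have "admissible_seq (dom ?H) (finsert (And \<phi> (Dia \<gamma> ?\<theta>), a @ [x]) \<Phi>)"
    using new adm'[OF _ unfolded] fp by (auto simp: admissible_And)
  ultimately have "G (translate_seq ?E (finsert (And \<phi> (Dia \<gamma> ?\<theta>), a @ [x]) \<Phi>))"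
    by (rule Clo_clo.IH)
  moreover have "translate ?E (a @ [x]) \<phi> = translate E a \<phi>"
    using owner by (simp add: translate_snoc_small a_upd)
  \<comment> \<open>Being last, \<open>x\<close> contributes the outermost guard, as the premise of
    \<open>G_ind\<close> requires.\<close>
  moreover have "guards ?E (a @ [x]) ?\<theta> = ?D @ [?\<chi>]"
    using owner \<open>x \<notin> set a\<close> by (auto simp: guards_def)
  \<comment> \<open>\<open>fp\<close> rules out the owners of names in \<open>a\<close>; comparing
    sizes rules out the owner of \<open>x\<close>.\<close>
  moreover have "translate ?E (a @ [x]) (Dia \<gamma> ?\<theta>) = Dia \<gamma> (translate ?E (a @ [x]) ?\<theta>)"
    using fp owner by (intro translate_unguarded) (auto dest: arg_cong[of _ _ size])
  ultimately have "G (finsert (And (translate E a \<phi>) (Dia \<gamma> (Dia (Cross (Seq (DTest ?\<chi>) (guard_game ?D \<gamma>)))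
      (Dia (DTest ?\<chi>) (guard_fml ?D (translate E a \<phi>)))))) ?\<Phi>)"
    using upd[OF adm(2)] by simp
  \<comment> \<open>\<open>G_ind\<close> is applied to the game and the formula already guarded by
    \<open>?D\<close>; deep inference supplies these guards in front.\<close>
  from deep_leD[OF deep_le_And[OF deep_le_guard deep_le_Dia[OF deep_gle_guard deep_le_refl]] this]
  have "G (finsert (And (guard_fml ?D (translate E a \<phi>))
      (Dia (guard_game ?D \<gamma>) (Dia (Cross (Seq (DTest ?\<chi>) (guard_game ?D \<gamma>)))
      (Dia (DTest ?\<chi>) (guard_fml ?D (translate E a \<phi>)))))) ?\<Phi>)" .
  then show ?case by (simp add: G_ind)
qed

theorem theorem5:
  fixes \<xi> :: "('p::countable, 'g::countable) fml"
  assumes "Clo_provable \<xi>"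
  shows "G_provable \<xi>"
proof -
  \<comment> \<open>With no names and no open assumptions, any interpretation serves and the
    translation is the identity.\<close>
  have "G (translate_seq undefined {|(\<xi>, [])|})"
    using assms unfolding Clo_provable_def
    by (rule Clo_imp_G_translate) (simp_all add: interprets_def)
  then show ?thesis by (simp add: G_provable_def)
qed

end
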